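(* A minimal surface in the Matsumoto space $(V^3,F_b)$ which is a translation surface defined on $\mathbb{R}^2$ is a plane. That is, if $f,g:\mathbb{R}\to\mathbb{R}$ are smooth and the immersion $\varphi:\mathbb{R}^2\to(V^3,F_b)$, $\varphi(x^1,x^2)=(x^1,x^2,f(x^1)+g(x^2))$, is minimal, then $\varphi(\mathbb{R}^2)$ is a plane.
   Context: Greek indices range over $\{1,2\}$, Latin indices over $\{1,2,3\}$, and repeated indices are summed. $V^3$ is a $3$-dimensional real vector space with linear coordinates $(\tilde x^1,\tilde x^2,\tilde x^3)$, and $F_b=\frac{\tilde\alpha^2}{\tilde\alpha-\tilde\beta}$ is the Minkowski Matsumoto metric on it, where $\tilde\alpha$ is the Euclidean metric, $\tilde\alpha(y)=\sqrt{(y^1)^2+(y^2)^2+(y^3)^2}$, and $\tilde\beta=b\,d\tilde x^3$, i.e. $\tilde\beta(y)=b\,y^3$, with $b$ a constant, $0\le b<1/2$ (and $F_b(0)=0$). "Plane" means a $2$-dimensional affine subspace of $V^3$. For a $3\times 2$ matrix $z=(z^i_\epsilon)$ of rank $2$ put $$\mathcal F(z)=\frac{\mathrm{vol}(B^2)}{\mathrm{vol}(D_z)},\qquad D_z=\{(y^1,y^2)\in\mathbb{R}^2: F_b(y^\epsilon z_\epsilon)<1\},\quad z_\epsilon=(z^1_\epsilon,z^2_\epsilon,z^3_\epsilon),$$ with $B^2$ the Euclidean unit disc and $\mathrm{vol}$ Euclidean area. For an immersion $\varphi$ with $z^i_\epsilon=\partial\varphi^i/\partial x^\epsilon$, the mean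 curvature (with respect to the Busemann-Hausdorff volume) is $$\mathcal H_\varphi(v)=\frac{1}{\mathcal F}\Big\{\frac{\partial^2\mathcal F}{\partial z^i_\epsilon\partial z^j_\eta}\frac{\partial^2\varphi^j}{\partial x^\epsilon\partial x^\eta}\Big\}v^i$$ for vector fields $v=(v^i)$ along $\varphi$; $\varphi$ (or the surface it parametrizes) is called minimal when $\mathcal H_\varphi=0$, i.e. $\mathcal H_\varphi(v)=0$ for all $v$. *)

theory Defs
  imports "HOL-Analysis.Analysis"
begin

(* For y = 0 the quotient is 0 / 0 = 0, in agreement with F_b(0) = 0. *)
definition matsumoto :: "real \<Rightarrow> real^3 \<Rightarrow> real" where
  "matsumoto b y = (norm y)\<^sup>2 / (norm y - b * y $ 3)"

(* z *v y is the linear combination of the columns z_1, z_2 of z with coefficients y. *)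
definition unit_domain :: "real \<Rightarrow> real^2^3 \<Rightarrow> (real^2) set" where
  "unit_domain b z = {y. matsumoto b (z *v y) < 1}"

(* Only meaningful for z of rank 2. *)
definition BH_density :: "real \<Rightarrow> real^2^3 \<Rightarrow> real" where
  "BH_density b z = measure lborel (ball (0::real^2) 1) / measure lborel (unit_domain b z)"

definition partial_deriv :: "'a::real_vector \<Rightarrow> ('a \<Rightarrow> real) \<Rightarrow> 'a \<Rightarrow> real" where
  "partial_deriv e h p = deriv (\<lambda>t. h (p + t *\<^sub>R e)) 0"

(* The direction of the coordinate z^i_eps on the space of 3 x 2 matrices. *)
definition matrix_unit :: "3 \<Rightarrow> 2 \<Rightarrow> real^2^3" where
  "matrix_unit i \<epsilon> = axis i (axis \<epsilon> 1)"

definition jacobian_matrix :: "(real^2 \<Rightarrow> real^3) \<Rightarrow> real^2 \<Rightarrow> real^2^3" where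
  "jacobian_matrix \<phi> x = (\<chi> i \<epsilon>. partial_deriv (axis \<epsilon> 1) (\<lambda>u. \<phi> u $ i) x)"

definition mean_curvature ::
  "real \<Rightarrow> (real^2 \<Rightarrow> real^3) \<Rightarrow> (real^2 \<Rightarrow> real^3) \<Rightarrow> real^2 \<Rightarrow> real" where
  "mean_curvature b \<phi> v x =
     1 / BH_density b (jacobian_matrix \<phi> x) *
     (\<Sum>i\<in>UNIV.
        (\<Sum>j\<in>UNIV. \<Sum>\<epsilon>\<in>UNIV. \<Sum>\<eta>\<in>UNIV.
           partial_deriv (matrix_unit i \<epsilon>) (partial_deriv (matrix_unit j \<eta>) (BH_density b))
             (jacobian_matrix \<phi> x) *
           partial_deriv (axis \<epsilon> 1) (partial_deriv (axis \<eta> 1) (\<lambda>u. \<phi> u $ j)) x) *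
        v x $ i)"

(* For immersions. No regularity of v is required: the mean curvature at x depends on v
   only through the vector v x. *)
definition minimal :: "real \<Rightarrow> (real^2 \<Rightarrow> real^3) \<Rightarrow> bool" where
  "minimal b \<phi> \<longleftrightarrow> (\<forall>v x. mean_curvature b \<phi> v x = 0)"

definition smooth :: "(real \<Rightarrow> real) \<Rightarrow> bool" where
  "smooth f \<longleftrightarrow> (\<forall>n x. (deriv ^^ n) f field_differentiable (at x))"

definition translation_surface :: "(real \<Rightarrow> real) \<Rightarrow> (real \<Rightarrow> real) \<Rightarrow> real^2 \<Rightarrow> real^3" where
  "translation_surface f g x = vector [x $ 1, x $ 2, f (x $ 1) + g (x $ 2)]"

definition plane :: "(real^3) set \<Rightarrow> bool" where
  "plane S \<longleftrightarrow> affine S \<and> aff_dim S = 2"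

(* A translation surface is always an immersion, hence this is not an assumption on it. *)
lemma translation_surface_immersion:
  "rank (jacobian_matrix (translation_surface f g) x) = 2"
proof -
  let ?J = "jacobian_matrix (translation_surface f g) x"
  have d: "deriv (\<lambda>t. c + t * a) 0 = a" for a c :: real
    by (rule DERIV_imp_deriv) (auto intro!: derivative_eq_intros)
  have J1: "?J $ 1 $ \<epsilon> = axis \<epsilon> 1 $ 1" and J2: "?J $ 2 $ \<epsilon> = axis \<epsilon> 1 $ 2" for \<epsilon>
    by (simp_all add: jacobian_matrix_def partial_deriv_def translation_surface_def
        vector_3 d)
  have "inj ((*v) ?J)"
  proof (rule injI)
    fix y y' :: "real^2"
    assume "?J *v y = ?J *v y'"
    then have "(?J *v y) $ 1 = (?J *v y') $ 1" "(?J *v y) $ 2 = (?J *v y') $ 2"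
      by simp_all
    then show "y = y'"
      by (simp add: matrix_vector_mult_def sum_2 J1 J2 axis_def vec_eq_iff forall_2)
  qed
  then show ?thesis
    using full_rank_injective[of ?J] by simp
qed

end

theory Submission imports Defs begin

text \<open>
  The tangent plane of a graph with gradient \<open>(p, q)\<close> meets the Matsumoto unit ball in a region
  that, in orthonormal coordinates of that plane, is bounded by the limacon
  \<open>r = 1 - b \<kappa> cos \<theta>\<close>, where \<open>\<kappa>\<close> is the length of the projection of the vertical unit
  vector to the plane, so that \<open>\<kappa>\<^sup>2 = (p\<^sup>2 + q\<^sup>2) / (1 + p\<^sup>2 + q\<^sup>2)\<close>. Its area is
  \<open>pi (1 + b\<^sup>2 \<kappa>\<^sup>2 / 2)\<close> (lemma \<open>limacon_area\<close>). This yields the density in closed form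
  (lemma \<open>BH_density_graph_matrix\<close>): with \<open>s = 1 + p\<^sup>2 + q\<^sup>2\<close>, \<open>a = 2 + b\<^sup>2\<close> and \<open>c = b\<^sup>2\<close>,
  it is \<open>2 s sqrt s / (a s - c)\<close>.

  For the height \<open>f(x) + g(y)\<close> the vertical component of the mean curvature vanishes exactly when
  \<open>P(f', g') f'' + P(g', f') g'' = 0\<close> for all \<open>x\<close> and \<open>y\<close>, where \<open>P(p, q)\<close> is
  \<open>s (a s - 3 c) (a s - c) - p\<^sup>2 (a\<^sup>2 s\<^sup>2 - 6 a c s - 3 c\<^sup>2)\<close>
  (lemma \<open>minimal_translation_surface_equation\<close>).

  For fixed \<open>q\<close> the coefficient \<open>P(p, q)\<close> is bounded above by a multiple of \<open>s\<^sup>2\<close>, and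
  \<open>P(q, p)\<close> is bounded below by a positive multiple of \<open>s\<^sup>2 (1 + p\<^sup>2)\<close>. If \<open>g''\<close> were negative
  at one point \<open>y\<close>, the equation with this \<open>y\<close> frozen would give \<open>f'' \<ge> k (1 + f'\<^sup>2)\<close> on the whole line
  with some \<open>k > 0\<close>. This is impossible, since \<open>arctan f'\<close> would be unbounded. So \<open>g'' \<ge> 0\<close>, and by
  symmetry \<open>f'' \<ge> 0\<close> (lemma \<open>minimal_equation_nonneg\<close>). Since both coefficients are positive, the
  equation then forces \<open>f'' = g'' = 0\<close>: the height is an affine function, and its graph is a plane.
\<close>

section \<open>The area of a limacon\<close>

text \<open>The derivative of a radial map \<open>u \<mapsto> \<rho> u *\<^sub>R u\<close> has this shape, with \<open>r = \<rho> u\<close> and \<open>a\<close>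
  the gradient of \<open>\<rho>\<close>. The last term disappears when \<open>\<rho>\<close> is constant on rays.\<close>

lemma det_scaling_plus_rank_one:
  fixes a u :: "real^2"
  shows "det (matrix (\<lambda>h. (a \<bullet> h) *\<^sub>R u + r *\<^sub>R h)) = r\<^sup>2 + r * (a \<bullet> u)"
  by (simp add: det_2 matrix_def axis_def inner_vec_def sum_2 power2_eq_square algebra_simps)

definition limacon :: "real^2 \<Rightarrow> (real^2) set" where
  "limacon c = {u. norm u < 1 - (c \<bullet> u) / norm u}"

lemma abs_inner_div_norm_le:
  fixes c u :: "'a::real_inner"
  shows "\<bar>(c \<bullet> u) / norm u\<bar> \<le> norm c"
  using Cauchy_Schwarz_ineq2[of c u] by (cases "u = 0") (auto simp: field_simps)

lemma limacon_lmeasurable: "limacon c \<in> lmeasurable"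
proof (rule bounded_set_imp_lmeasurable)
  have "norm u \<le> 1 + norm c" if "u \<in> limacon c" for u
    using that abs_inner_div_norm_le[of c u] unfolding limacon_def mem_Collect_eq by linarith
  then show "bounded (limacon c)"
    by (auto simp: bounded_iff)
  have "{u \<in> space borel. norm u < 1 - (c \<bullet> u) / norm u} \<in> sets borel"
    by measurable
  then show "limacon c \<in> sets lebesgue"
    by (simp add: limacon_def)
qed

text \<open>Only the length of \<open>c\<close> matters for the area, because the defining inequality involves
  norms and inner products alone.\<close>

lemma limacon_orthogonal_image:
  assumes T: "orthogonal_transformation T"
  shows "limacon (T c) = T ` limacon c"
proof -
  have "T x \<in> limacon (T c) \<longleftrightarrow> x \<in> limacon c" for x
    using T by (simp add: limacon_def orthogonal_transformation_def orthogonal_transformation_norm)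
  then show ?thesis
    using orthogonal_transformation_surj[OF T] by (auto simp: image_iff surj_def) metis
qed

text \<open>The radius function \<open>\<rho> u = 1 - (c \<bullet> u) / norm u\<close> is constant on rays, so the map
  \<open>u \<mapsto> \<rho> u *\<^sub>R u\<close> stretches the disc onto the limacon one ray at a time, and its Jacobian
  determinant is \<open>(\<rho> u)\<^sup>2\<close>. The origin is removed because \<open>\<rho>\<close> is not differentiable there.\<close>

lemma limacon_area_eq_disc_integral:
  assumes c: "norm c < 1"
  shows "((\<lambda>u. (1 - (c \<bullet> u) / norm u)\<^sup>2) has_integral measure lebesgue (limacon c)) (ball 0 1 - {0})"
proof -
  define \<rho> where "\<rho> u = 1 - (c \<bullet> u) / norm u" for u
  define a where "a u = ((c \<bullet> u) / norm u ^ 3) *\<^sub>R u - c /\<^sub>R norm u" for u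
  define B where "B = ball (0::real^2) 1 - {0}"
  have rho_bounds: "0 < \<rho> u" "\<bar>\<rho> u\<bar> \<le> 2" for u
    using abs_inner_div_norm_le[of c u] c unfolding \<rho>_def by linarith+
  have rho_scale: "\<rho> (t *\<^sub>R u) = \<rho> u" if "t > 0" for t u
    using that by (simp add: \<rho>_def)
  have der: "((\<lambda>u. \<rho> u *\<^sub>R u) has_derivative (\<lambda>h. (a u \<bullet> h) *\<^sub>R u + \<rho> u *\<^sub>R h)) (at u within B)"
    if "u \<in> B" for u
  proof -
    have u: "u \<noteq> 0" using that by (simp add: B_def)
    have nd: "(norm has_derivative (\<lambda>h. sgn u \<bullet> h)) (at u within B)"
      using has_derivative_at_withinI[OF has_derivative_norm[OF u]] by (simp add: fun_eq_iff inner_commute)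
    have "(\<rho> has_derivative (\<lambda>h. a u \<bullet> h)) (at u within B)"
      unfolding \<rho>_def
      apply (rule has_derivative_eq_rhs)
       apply (rule derivative_intros nd | simp add: u)+
      using u by (simp add: a_def fun_eq_iff sgn_div_norm inner_diff_left field_simps power3_eq_cube)
    from has_derivative_scaleR[OF this has_derivative_ident] show ?thesis
      by (simp add: add.commute)
  qed
  have detr: "det (matrix (\<lambda>h. (a u \<bullet> h) *\<^sub>R u + \<rho> u *\<^sub>R h)) = (\<rho> u)\<^sup>2" for u
  proof -
    \<comment> \<open>Euler's relation for a function that is homogeneous of degree 0.\<close>
    have "a u \<bullet> u = 0"
      by (cases "u = 0") (simp_all add: a_def inner_diff_left dot_square_norm power3_eq_cube power2_eq_square field_simps)
    then show ?thesis
      by (simp add: det_scaling_plus_rank_one)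
  qed
  have inj: "inj_on (\<lambda>u. \<rho> u *\<^sub>R u) B"
  proof (rule inj_onI)
    fix u v assume eq: "\<rho> u *\<^sub>R u = \<rho> v *\<^sub>R v"
    then have "\<rho> u = \<rho> v"
      using rho_scale[OF rho_bounds(1), of u u] rho_scale[OF rho_bounds(1), of v v] by simp
    then show "u = v" using eq rho_bounds(1)[of v] by simp
  qed
  have img: "(\<lambda>u. \<rho> u *\<^sub>R u) ` B = limacon c - {0}"
  proof (intro equalityI subsetI)
    fix v assume "v \<in> (\<lambda>u. \<rho> u *\<^sub>R u) ` B"
    then obtain u where u: "u \<in> B" "v = \<rho> u *\<^sub>R u" by auto
    have "norm v < \<rho> v"
      using u rho_bounds(1)[of u] rho_scale[OF rho_bounds(1), of u u] by (simp add: B_def)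
    moreover have "v \<noteq> 0" using u rho_bounds(1)[of u] by (simp add: B_def)
    ultimately show "v \<in> limacon c - {0}" by (simp add: limacon_def \<rho>_def)
  next
    fix v assume v: "v \<in> limacon c - {0}"
    define u where "u = (1 / \<rho> v) *\<^sub>R v"
    have "\<rho> u = \<rho> v" unfolding u_def by (rule rho_scale) (simp add: rho_bounds)
    then have "v = \<rho> u *\<^sub>R u" using rho_bounds(1)[of v] by (simp add: u_def)
    moreover have "norm v < \<rho> v" using v by (simp add: limacon_def \<rho>_def)
    then have "u \<in> B" using v rho_bounds(1)[of v] by (simp add: B_def u_def)
    ultimately show "v \<in> (\<lambda>u. \<rho> u *\<^sub>R u) ` B" by blast
  qed
  have Bm: "B \<in> lmeasurable" by (auto simp: B_def intro!: lmeasurable_open bounded_subset[OF bounded_ball])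
  have int: "(\<lambda>u. (\<rho> u)\<^sup>2) integrable_on B"
  proof (rule measurable_bounded_by_integrable_imp_integrable)
    have "(\<lambda>u. (\<rho> u)\<^sup>2) \<in> borel_measurable borel"
      unfolding \<rho>_def by measurable
    then show "(\<lambda>u. (\<rho> u)\<^sup>2) \<in> borel_measurable (lebesgue_on B)"
      by (intro measurable_restrict_space1 measurable_completion) simp
    show "(\<lambda>u. 2\<^sup>2 :: real) integrable_on B"
      using Bm by (rule integrable_on_const)
    show "norm ((\<rho> u)\<^sup>2) \<le> 2\<^sup>2" for u
      using power_mono[OF rho_bounds(2)[of u], of 2] by simp
    show "B \<in> sets lebesgue" using Bm by blast
  qed
  have "measure lebesgue ((\<lambda>u. \<rho> u *\<^sub>R u) ` B) = integral B (\<lambda>u. (\<rho> u)\<^sup>2)"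
    using measure_differentiable_image_eq[OF _ der inj] Bm int by (simp add: detr fmeasurableD)
  moreover have "measure lebesgue (limacon c - {0}) = measure lebesgue (limacon c)"
    by (rule measure_negligible_symdiff) (auto simp: limacon_lmeasurable  intro: negligible_subset[of "{0}"])
  ultimately show ?thesis
    using int img unfolding B_def \<rho>_def by (simp add: has_integral_iff)
qed

text \<open>Multiplication by the imaginary unit, in real coordinates.\<close>

definition quarter_turn :: "real^2 \<Rightarrow> real^2" where
  "quarter_turn u = vector [- u $ 2, u $ 1]"

lemma orthogonal_quarter_turn: "orthogonal_transformation quarter_turn"
proof -
  have "linear quarter_turn"
    by (rule linearI) (simp_all add: quarter_turn_def vec_eq_iff forall_2 vector_2)
  then show ?thesis
    by (simp add: orthogonal_transformation_def quarter_turn_def inner_vec_def sum_2 vector_2)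
qed

text \<open>The limacons of \<open>c\<close>, \<open>-c\<close>, \<open>J c\<close> and \<open>-J c\<close>, with \<open>J\<close> the quarter turn, have the same area.
  When their disc integrals are added, opposite vectors cancel the terms linear in \<open>c\<close>, and the
  orthogonal vectors \<open>c\<close>, \<open>J c\<close> turn the quadratic terms into a constant by Pythagoras. The sum is
  therefore the integral of a constant.\<close>

lemma limacon_area:
  assumes c: "norm c < 1"
  shows "measure lebesgue (limacon c) = pi * (1 + (norm c)\<^sup>2 / 2)"
proof -
  define B where "B = ball (0::real^2) 1 - {0}"
  define M where "M = measure lebesgue (limacon c)"
  define J where "J = quarter_turn"
  have J: "orthogonal_transformation J" and nJ: "norm (J c) = norm c"
    by (simp_all add: J_def orthogonal_quarter_turn orthogonal_transformation_norm[OF orthogonal_quarter_turn])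
  have neg: "orthogonal_transformation (uminus :: real^2 \<Rightarrow> real^2)"
    by (simp add: orthogonal_transformation_neg[of "\<lambda>x. x", simplified])
  have same: "measure lebesgue (limacon (T d)) = measure lebesgue (limacon d)"
    if "orthogonal_transformation T" for T d
    using that by (simp add: limacon_orthogonal_image measure_orthogonal_image limacon_lmeasurable)
  have I: "((\<lambda>u. (1 - (d \<bullet> u) / norm u)\<^sup>2) has_integral M) B" if "d \<in> {c, -c, J c, - J c}" for d
    using limacon_area_eq_disc_integral[of d] that same[OF neg] same[OF J] c nJ
    by (auto simp: M_def B_def)
  have "((\<lambda>u. ((1 - (c \<bullet> u) / norm u)\<^sup>2 + (1 - (- c \<bullet> u) / norm u)\<^sup>2)
      + ((1 - (J c \<bullet> u) / norm u)\<^sup>2 + (1 - (- J c \<bullet> u) / norm u)\<^sup>2)) has_integral (M + M) + (M + M)) B"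
    by (intro has_integral_add I) auto
  moreover have "((1 - (c \<bullet> u) / norm u)\<^sup>2 + (1 - (- c \<bullet> u) / norm u)\<^sup>2)
      + ((1 - (J c \<bullet> u) / norm u)\<^sup>2 + (1 - (- J c \<bullet> u) / norm u)\<^sup>2) = 4 + 2 * (norm c)\<^sup>2" if "u \<in> B" for u
  proof -
    have u: "norm u \<noteq> 0" using that by (simp add: B_def)
    have "(c \<bullet> u)\<^sup>2 + (J c \<bullet> u)\<^sup>2 = (c \<bullet> c) * (u \<bullet> u)"
      by (simp add: J_def quarter_turn_def inner_vec_def sum_2 vector_2 power2_eq_square algebra_simps)
    then have "((c \<bullet> u) / norm u)\<^sup>2 + ((J c \<bullet> u) / norm u)\<^sup>2 = (norm c)\<^sup>2"
      using u by (simp add: power_divide add_divide_distrib[symmetric] dot_square_norm)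
    moreover have "((1 - s)\<^sup>2 + (1 - - s)\<^sup>2) + ((1 - t)\<^sup>2 + (1 - - t)\<^sup>2) = 4 + 2 * (s\<^sup>2 + t\<^sup>2)" for s t :: real
      by (simp add: power2_eq_square algebra_simps)
    ultimately show ?thesis by simp
  qed
  ultimately have "((\<lambda>u. 4 + 2 * (norm c)\<^sup>2) has_integral 4 * M) B"
    by (subst has_integral_cong[symmetric]) (auto simp: )
  moreover have "((\<lambda>u. 4 + 2 * (norm c)\<^sup>2) has_integral (4 + 2 * (norm c)\<^sup>2) * pi) B"
  proof -
    have "((\<lambda>u. 1::real) has_integral measure lebesgue (ball (0::real^2) 1)) (ball (0::real^2) 1)"
      using lmeasure_integral[OF lmeasurable_ball, of 0 1] lmeasurable_ball[of "0::real^2" 1]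
      by (metis integrable_integral lmeasurable_iff_integrable_on)
    then have "((\<lambda>u. 1::real) has_integral pi) (ball (0::real^2) 1)"
      by (simp add: content_ball unit_ball_vol_2)
    then have "((\<lambda>u. 1::real) has_integral pi) B"
      by (rule has_integral_spike_set_eq[THEN iffD1, rotated -1]) (auto simp: B_def intro: negligible_subset[of "{0}"])
    from has_integral_mult_right[OF this, of "4 + 2 * (norm c)\<^sup>2"] show ?thesis by simp
  qed
  ultimately have "4 * M = (4 + 2 * (norm c)\<^sup>2) * pi"
    by (rule has_integral_unique)
  then show ?thesis by (simp add: M_def field_simps)
qed

section \<open>The area density of a graph\<close>

text \<open>The Jacobian matrix of a graph \<open>(x\<^sub>1, x\<^sub>2, h(x\<^sub>1, x\<^sub>2))\<close> whose height has gradient \<open>(p, q)\<close>.\<close>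

definition graph_matrix :: "real \<Rightarrow> real \<Rightarrow> real^2^3" where
  "graph_matrix p q = vector [axis 1 1, axis 2 1, vector [p, q]]"

lemma graph_matrix_mult:
  "(graph_matrix p q *v y) $ 1 = y $ 1"
  "(graph_matrix p q *v y) $ 2 = y $ 2"
  "(graph_matrix p q *v y) $ 3 = p * y $ 1 + q * y $ 2"
  by (simp_all add: graph_matrix_def matrix_vector_mult_def sum_2 vector_3 vector_2 axis_def)

text \<open>The columns result from the Gram-Schmidt process applied to the standard basis and the
  inner product that \<open>graph_matrix p q\<close> pulls back to the plane. Hence \<open>graph_matrix p q\<close> after
  this map is an isometric embedding.\<close>

definition cholesky_map :: "real \<Rightarrow> real \<Rightarrow> real^2 \<Rightarrow> real^2" where
  "cholesky_map p q u =
     vector [u $ 1 / sqrt (1 + p\<^sup>2) - p * q * u $ 2 / (sqrt (1 + p\<^sup>2) * sqrt (1 + p\<^sup>2 + q\<^sup>2)),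
             sqrt (1 + p\<^sup>2) / sqrt (1 + p\<^sup>2 + q\<^sup>2) * u $ 2]"

text \<open>The vector representing the third coordinate in these orthonormal coordinates of the tangent
  plane: the orthogonal projection of the vertical unit vector.\<close>

definition height_functional :: "real \<Rightarrow> real \<Rightarrow> real^2" where
  "height_functional p q =
     vector [p / sqrt (1 + p\<^sup>2), q / (sqrt (1 + p\<^sup>2) * sqrt (1 + p\<^sup>2 + q\<^sup>2))]"

lemma linear_cholesky_map: "linear (cholesky_map p q)"
  by (rule linearI) (simp_all add: cholesky_map_def vec_eq_iff forall_2 vector_2 add_divide_distrib algebra_simps)

lemma det_cholesky_map: "det (matrix (cholesky_map p q)) = 1 / sqrt (1 + p\<^sup>2 + q\<^sup>2)"
proof -
  have "sqrt (1 + p\<^sup>2) \<noteq> 0" by (smt (verit) real_sqrt_eq_0_iff zero_le_power2)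
  then show ?thesis
    by (simp add: det_2 matrix_def cholesky_map_def vector_2 axis_def)
qed

lemma surj_cholesky_map: "surj (cholesky_map p q)"
proof -
  have "1 + p\<^sup>2 + q\<^sup>2 \<noteq> 0" by (smt (verit) zero_le_power2)
  then show ?thesis
    by (metis det_cholesky_map linear_cholesky_map det_nz_iff_inj linear_injective_imp_surjective
        divide_eq_0_iff real_sqrt_eq_0_iff zero_neq_one)
qed

lemma graph_matrix_cholesky:
  "norm (graph_matrix p q *v cholesky_map p q u) = norm u" (is ?norm)
  "(graph_matrix p q *v cholesky_map p q u) $ 3 = height_functional p q \<bullet> u" (is ?height)
proof -
  define R s where "R = sqrt (1 + p\<^sup>2)" and "s = sqrt (1 + p\<^sup>2 + q\<^sup>2)"
  have "1 + p\<^sup>2 > 0" "1 + p\<^sup>2 + q\<^sup>2 > 0" by (smt (verit) zero_le_power2)+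
  then have pos: "R > 0" "s > 0" and sq: "R\<^sup>2 = 1 + p\<^sup>2" "s\<^sup>2 = R\<^sup>2 + q\<^sup>2"
    by (simp_all add: R_def s_def)
  define a b where "a = u $ 1" and "b = u $ 2"
  have "p * (a / R - p * q * b / (R * s)) + q * (R / s * b) = p / R * a + q * b * (R\<^sup>2 - p\<^sup>2) / (R * s)"
    using pos by (simp add: field_simps power2_eq_square)
  then have h: "p * (a / R - p * q * b / (R * s)) + q * (R / s * b) = p / R * a + q / (R * s) * b"
    by (simp add: sq)
  then show ?height
    by (simp add: graph_matrix_mult cholesky_map_def height_functional_def inner_vec_def sum_2 vector_2
        R_def s_def a_def b_def)
  have "(a / R - p * q * b / (R * s))\<^sup>2 + (R / s * b)\<^sup>2 + (p / R * a + q / (R * s) * b)\<^sup>2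
    = a\<^sup>2 * ((1 + p\<^sup>2) / R\<^sup>2) + b\<^sup>2 * (((1 + p\<^sup>2) * q\<^sup>2 + (R\<^sup>2)\<^sup>2) / (R\<^sup>2 * s\<^sup>2))"
    using pos by (simp add: field_simps power2_eq_square)
  also have "\<dots> = a\<^sup>2 * (R\<^sup>2 / R\<^sup>2) + b\<^sup>2 * (R\<^sup>2 * s\<^sup>2 / (R\<^sup>2 * s\<^sup>2))"
    unfolding sq(2) sq(1)[symmetric] by (simp add: algebra_simps power2_eq_square)
  also have "\<dots> = a\<^sup>2 + b\<^sup>2" using pos by simp
  finally have "(a / R - p * q * b / (R * s))\<^sup>2 + (R / s * b)\<^sup>2
      + (p * (a / R - p * q * b / (R * s)) + q * (R / s * b))\<^sup>2 = a\<^sup>2 + b\<^sup>2"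
    unfolding h .
  then show ?norm
    by (simp add: norm_vec_def L2_set_def sum_2 sum_3 graph_matrix_mult cholesky_map_def vector_2
        R_def s_def a_def b_def)
qed

lemma norm_height_functional:
  "(norm (height_functional p q))\<^sup>2 = (p\<^sup>2 + q\<^sup>2) / (1 + p\<^sup>2 + q\<^sup>2)"
proof -
  have pos: "1 + p\<^sup>2 > 0" "1 + p\<^sup>2 + q\<^sup>2 > 0" by (smt (verit) zero_le_power2)+
  have "(norm (height_functional p q))\<^sup>2 = p\<^sup>2 / (1 + p\<^sup>2) + q\<^sup>2 / ((1 + p\<^sup>2) * (1 + p\<^sup>2 + q\<^sup>2))"
    using pos by (simp add: norm_vec_def L2_set_def sum_2 height_functional_def vector_2 power_divide power_mult_distrib)
  also have "\<dots> = (p\<^sup>2 + q\<^sup>2) / (1 + p\<^sup>2 + q\<^sup>2)"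
    using pos by (simp add: divide_simps) algebra
  finally show ?thesis .
qed

lemma norm_height_functional_less_1: "norm (height_functional p q) < 1"
proof -
  have "1 + p\<^sup>2 + q\<^sup>2 > 0" by (smt (verit) zero_le_power2)+
  then have "(norm (height_functional p q))\<^sup>2 < 1\<^sup>2"
    by (simp add: norm_height_functional)
  then show ?thesis by (rule power2_less_imp_less) simp
qed

text \<open>Clearing the denominator is allowed where it is positive. At \<open>w = 0\<close> both sides hold,
  thanks to the convention \<open>0 / 0 = 0\<close>.\<close>

lemma matsumoto_less_1_iff:
  assumes "\<bar>b * w $ 3\<bar> < norm w \<or> w = 0"
  shows "matsumoto b w < 1 \<longleftrightarrow> norm w < 1 - b * w $ 3 / norm w"
proof (cases "w = 0")
  case False
  then have "norm w > 0" "norm w - b * w $ 3 > 0" using assms by auto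
  then show ?thesis by (simp add: matsumoto_def field_simps power2_eq_square)
qed (simp add: matsumoto_def)

text \<open>In orthonormal coordinates of the tangent plane the norm is the Euclidean one and the form
  \<open>b dx\<^sup>3\<close> is the inner product with \<open>b *\<^sub>R height_functional p q\<close>.\<close>

lemma unit_domain_graph_matrix:
  assumes "0 \<le> b" "b < 1"
  shows "unit_domain b (graph_matrix p q) = cholesky_map p q ` limacon (b *\<^sub>R height_functional p q)"
proof -
  let ?m = "height_functional p q"
  have "matsumoto b (graph_matrix p q *v cholesky_map p q u) < 1 \<longleftrightarrow> u \<in> limacon (b *\<^sub>R ?m)" for u
  proof -
    let ?w = "graph_matrix p q *v cholesky_map p q u"
    have "\<bar>b * ?w $ 3\<bar> < norm ?w \<or> ?w = 0"
    proof (cases "u = 0")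
      case False
      have "\<bar>b * ?w $ 3\<bar> \<le> b * (norm ?m * norm u)"
        using mult_left_mono[OF Cauchy_Schwarz_ineq2[of ?m u] assms(1)] assms(1)
        by (simp add: graph_matrix_cholesky abs_mult)
      also have "\<dots> \<le> b * norm u"
        using assms norm_height_functional_less_1[of p q] by (intro mult_left_mono mult_left_le_one_le) auto
      also have "\<dots> < norm u" using assms False by simp
      finally show ?thesis by (simp add: graph_matrix_cholesky)
    qed (metis norm_eq_zero graph_matrix_cholesky(1))
    from matsumoto_less_1_iff[OF this] show ?thesis
      by (simp add: limacon_def graph_matrix_cholesky)
  qed
  moreover have "unit_domain b (graph_matrix p q) =
      cholesky_map p q ` (cholesky_map p q -` unit_domain b (graph_matrix p q))"
    using surj_image_vimage_eq[OF surj_cholesky_map] by simp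
  ultimately show ?thesis
    unfolding unit_domain_def by (simp add: vimage_def)
qed

lemma unit_domain_borel: "unit_domain b z \<in> sets borel"
proof -
  have [measurable]: "(\<lambda>y. z *v y) \<in> borel_measurable borel"
    by (intro borel_measurable_continuous_onI linear_continuous_on matrix_vector_mul_bounded_linear)
  have [measurable]: "(\<lambda>w::real^3. w $ 3) \<in> borel_measurable borel"
    by (intro borel_measurable_continuous_onI continuous_intros)
  have "{y \<in> space borel. matsumoto b (z *v y) < 1} \<in> sets borel"
    unfolding matsumoto_def by measurable
  then show ?thesis by (simp add: unit_domain_def)
qed

lemma unit_domain_graph_area:
  assumes "0 \<le> b" "b < 1"
  shows "measure lborel (unit_domain b (graph_matrix p q)) =
    pi * (1 + b\<^sup>2 * (p\<^sup>2 + q\<^sup>2) / (2 * (1 + p\<^sup>2 + q\<^sup>2))) / sqrt (1 + p\<^sup>2 + q\<^sup>2)"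
proof -
  let ?m = "height_functional p q"
  have pos: "1 + p\<^sup>2 + q\<^sup>2 > 0" by (smt (verit) zero_le_power2)+
  have "norm (b *\<^sub>R ?m) < 1"
    using assms norm_height_functional_less_1[of p q] mult_strict_mono'[of b 1 "norm ?m" 1] by simp
  note L = limacon_area[OF this]
  have "measure lborel (unit_domain b (graph_matrix p q)) = measure lebesgue (unit_domain b (graph_matrix p q))"
    using unit_domain_borel by simp
  also have "\<dots> = \<bar>det (matrix (cholesky_map p q))\<bar> * measure lebesgue (limacon (b *\<^sub>R ?m))"
    unfolding unit_domain_graph_matrix[OF assms]
    by (rule measure_linear_image[OF linear_cholesky_map limacon_lmeasurable])
  also have "\<dots> = 1 / sqrt (1 + p\<^sup>2 + q\<^sup>2) * (pi * (1 + b\<^sup>2 * ((p\<^sup>2 + q\<^sup>2) / (1 + p\<^sup>2 + q\<^sup>2)) / 2))"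
    using pos by (simp add: L det_cholesky_map power_mult_distrib norm_height_functional)
  finally show ?thesis by (simp add: mult.commute)
qed

text \<open>The Busemann-Hausdorff area density of a graph, as a function of its gradient.\<close>

definition graph_density :: "real \<Rightarrow> real \<Rightarrow> real \<Rightarrow> real" where
  "graph_density b p q =
     2 * ((1 + p\<^sup>2 + q\<^sup>2) * sqrt (1 + p\<^sup>2 + q\<^sup>2)) / ((2 + b\<^sup>2) * (1 + p\<^sup>2 + q\<^sup>2) - b\<^sup>2)"

lemma BH_density_graph_matrix:
  assumes "0 \<le> b" "b < 1"
  shows "BH_density b (graph_matrix p q) = graph_density b p q"
proof -
  define S where "S = 1 + p\<^sup>2 + q\<^sup>2"
  have S: "S \<ge> 1" and pq: "p\<^sup>2 + q\<^sup>2 = S - 1" by (simp_all add: S_def)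
  have n: "2 * S + b\<^sup>2 * (S - 1) > 0" using S by (intro add_pos_nonneg) auto
  then have n': "(2 + b\<^sup>2) * S - b\<^sup>2 > 0" by (simp add: algebra_simps)
  have "BH_density b (graph_matrix p q) = pi / (pi * (1 + b\<^sup>2 * (S - 1) / (2 * S)) / sqrt S)"
    unfolding BH_density_def unit_domain_graph_area[OF assms] S_def[symmetric] pq
    by (simp add: content_ball unit_ball_vol_2)
  also have "\<dots> = sqrt S / (1 + b\<^sup>2 * (S - 1) / (2 * S))"
    by simp
  also have "1 + b\<^sup>2 * (S - 1) / (2 * S) = ((2 + b\<^sup>2) * S - b\<^sup>2) / (2 * S)"
    using S by (simp add: field_simps)
  also have "sqrt S / (((2 + b\<^sup>2) * S - b\<^sup>2) / (2 * S)) = 2 * (S * sqrt S) / ((2 + b\<^sup>2) * S - b\<^sup>2)"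
    by simp
  finally show ?thesis by (simp add: graph_density_def S_def)
qed

section \<open>Second derivatives of the density\<close>

text \<open>The density of a graph depends on the gradient only through \<open>s = 1 + p\<^sup>2 + q\<^sup>2\<close>.\<close>

definition density_profile :: "real \<Rightarrow> real \<Rightarrow> real" where
  "density_profile b s = 2 * (s * sqrt s) / ((2 + b\<^sup>2) * s - b\<^sup>2)"

definition density_profile' :: "real \<Rightarrow> real \<Rightarrow> real" where
  "density_profile' b s = sqrt s * ((2 + b\<^sup>2) * s - 3 * b\<^sup>2) / ((2 + b\<^sup>2) * s - b\<^sup>2)\<^sup>2"

text \<open>Up to a positive factor this is the second derivative of \<open>graph_density b p q\<close> in \<open>p\<close>,
  written with \<open>s = 1 + p\<^sup>2 + q\<^sup>2\<close>. By symmetry, exchanging \<open>p\<close> and \<open>q\<close> gives the second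
  derivative in \<open>q\<close>.\<close>

definition elliptic_coeff :: "real \<Rightarrow> real \<Rightarrow> real \<Rightarrow> real" where
  "elliptic_coeff b p q =
     (let a = 2 + b\<^sup>2; c = b\<^sup>2; s = 1 + p\<^sup>2 + q\<^sup>2 in
       s * (a * s - 3 * c) * (a * s - c) - p\<^sup>2 * (a\<^sup>2 * s\<^sup>2 - 6 * a * c * s - 3 * c\<^sup>2))"

lemma denominator_pos: "s \<ge> 1 \<Longrightarrow> (2 + b\<^sup>2) * s - b\<^sup>2 > (0::real)"
proof -
  assume s: "s \<ge> 1"
  then have "2 * s + b\<^sup>2 * (s - 1) > 0" by (intro add_pos_nonneg) auto
  then show ?thesis by (simp add: algebra_simps)
qed

lemma density_profile_deriv:
  assumes s: "s \<ge> 1"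
  shows "(density_profile b has_real_derivative density_profile' b s) (at s)"
proof -
  define a c where "a = 2 + b\<^sup>2" and "c = b\<^sup>2"
  define r where "r = sqrt s"
  have r: "r > 0" "s = r * r" using s by (simp_all add: r_def)
  have d: "a * s - c \<noteq> 0" using denominator_pos[OF s, of b] by (simp add: a_def c_def)
  have "((\<lambda>s. 2 * (s * sqrt s) / (a * s - c)) has_real_derivative
      (2 * (sqrt s + s * (inverse (sqrt s) / 2)) * (a * s - c) - 2 * (s * sqrt s) * a) / ((a * s - c) * (a * s - c))) (at s)"
  proof -
    have "(sqrt has_real_derivative inverse (sqrt s) / 2) (at s)"
      using s by (intro DERIV_real_sqrt) simp
    from DERIV_cmult[OF DERIV_mult[OF DERIV_ident this], of 2]
    have "((\<lambda>s. 2 * (s * sqrt s)) has_real_derivative 2 * (sqrt s + s * (inverse (sqrt s) / 2))) (at s)"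
      by (simp add: mult.commute)
    moreover have "((\<lambda>s. a * s - c) has_real_derivative a) (at s)"
      by (auto intro!: derivative_eq_intros)
    ultimately show ?thesis
      using DERIV_divide d by blast
  qed
  also have "(2 * (sqrt s + s * (inverse (sqrt s) / 2)) * (a * s - c) - 2 * (s * sqrt s) * a) / ((a * s - c) * (a * s - c))
     = r * (a * s - 3 * c) / (a * s - c)\<^sup>2"
    using r(1) by (simp add: r_def[symmetric] r(2) field_simps power2_eq_square)
  finally show ?thesis
    unfolding density_profile_def[abs_def] density_profile'_def a_def c_def r_def .
qed

lemma density_profile'_deriv:
  fixes b s :: real
  assumes s: "s \<ge> 1"
  defines "a \<equiv> 2 + b\<^sup>2" and "c \<equiv> b\<^sup>2"
  shows "(density_profile' b has_real_derivative
    - (a\<^sup>2 * s\<^sup>2 - 6 * a * c * s - 3 * c\<^sup>2) / (2 * sqrt s * (a * s - c) ^ 3)) (at s)"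
proof -
  define r where "r = sqrt s"
  have r: "r > 0" "s = r * r" using s by (simp_all add: r_def)
  define D where "D = a * s - c"
  have d: "D \<noteq> 0" using denominator_pos[OF s, of b] by (simp add: a_def c_def D_def)
  have "((\<lambda>s. sqrt s * (a * s - 3 * c) / (a * s - c)\<^sup>2) has_real_derivative
      ((inverse (sqrt s) / 2 * (a * s - 3 * c) + sqrt s * a) * D\<^sup>2
        - sqrt s * (a * s - 3 * c) * (2 * D * a)) / (D\<^sup>2 * D\<^sup>2)) (at s)"
    using d s by (auto intro!: derivative_eq_intros simp: D_def field_simps)
  also have "((inverse (sqrt s) / 2 * (a * s - 3 * c) + sqrt s * a) * D\<^sup>2
        - sqrt s * (a * s - 3 * c) * (2 * D * a)) / (D\<^sup>2 * D\<^sup>2)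
     = (((a * s - 3 * c) + 2 * s * a) * D - 4 * a * s * (a * s - 3 * c)) / (2 * r * D ^ 3)"
    using r(1) d by (simp add: r_def[symmetric] r(2) divide_simps power2_eq_square power3_eq_cube) (simp add: algebra_simps)
  also have "((a * s - 3 * c) + 2 * s * a) * D - 4 * a * s * (a * s - 3 * c)
     = - (a\<^sup>2 * s\<^sup>2 - 6 * a * c * s - 3 * c\<^sup>2)"
    by (simp add: D_def power2_eq_square algebra_simps)
  finally show ?thesis
    unfolding density_profile'_def[abs_def] a_def c_def r_def D_def .
qed

lemma graph_density_eq_profile: "graph_density b p q = density_profile b (1 + p\<^sup>2 + q\<^sup>2)"
  by (simp add: graph_density_def density_profile_def)

lemma graph_density_commute: "graph_density b p q = graph_density b q p"
  by (simp add: graph_density_def add.commute add.left_commute)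

lemma graph_density_deriv:
  "((\<lambda>p. graph_density b p q) has_real_derivative 2 * p * density_profile' b (1 + p\<^sup>2 + q\<^sup>2)) (at p)"
  unfolding graph_density_eq_profile
  by (rule DERIV_chain2[OF density_profile_deriv, THEN DERIV_cong])
     (auto intro!: derivative_eq_intros)

lemma graph_density_deriv2:
  "((\<lambda>p. 2 * p * density_profile' b (1 + p\<^sup>2 + q\<^sup>2)) has_real_derivative
     2 * elliptic_coeff b p q / (sqrt (1 + p\<^sup>2 + q\<^sup>2) * ((2 + b\<^sup>2) * (1 + p\<^sup>2 + q\<^sup>2) - b\<^sup>2) ^ 3)) (at p)"
proof -
  define s a c where "s = 1 + p\<^sup>2 + q\<^sup>2" and "a = 2 + b\<^sup>2" and "c = b\<^sup>2"
  define r where "r = sqrt s"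
  define D where "D = a * s - c"
  define B where "B = a\<^sup>2 * s\<^sup>2 - 6 * a * c * s - 3 * c\<^sup>2"
  have s: "s \<ge> 1" by (simp add: s_def)
  have r: "r > 0" "s = r * r" using s by (simp_all add: r_def)
  have d: "D \<noteq> 0" using denominator_pos[OF s, of b] by (simp add: a_def c_def D_def)
  have sd: "((\<lambda>p. 1 + p\<^sup>2 + q\<^sup>2) has_real_derivative 2 * p) (at p)"
    by (auto intro!: derivative_eq_intros)
  have "((\<lambda>p. density_profile' b (1 + p\<^sup>2 + q\<^sup>2)) has_real_derivative - B / (2 * r * D ^ 3) * (2 * p)) (at p)"
    using DERIV_chain2[OF density_profile'_deriv sd] s
    unfolding s_def a_def c_def r_def D_def B_def by simp
  then have "((\<lambda>p. 2 * p * density_profile' b (1 + p\<^sup>2 + q\<^sup>2)) has_real_derivative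
      2 * density_profile' b s + 2 * p * (- B / (2 * r * D ^ 3) * (2 * p))) (at p)"
    by (auto intro!: derivative_eq_intros simp: s_def)
  also have "density_profile' b s = r * (a * s - 3 * c) / D\<^sup>2"
    by (simp add: density_profile'_def r_def D_def a_def c_def)
  also have "2 * (r * (a * s - 3 * c) / D\<^sup>2) + 2 * p * (- B / (2 * r * D ^ 3) * (2 * p))
    = 2 * (s * (a * s - 3 * c) * D - p\<^sup>2 * B) / (r * D ^ 3)"
    using r(1) d by (simp add: r(2) field_simps power2_eq_square power3_eq_cube)
  also have "s * (a * s - 3 * c) * D - p\<^sup>2 * B = elliptic_coeff b p q"
    by (simp add: elliptic_coeff_def Let_def s_def a_def c_def D_def B_def)
  finally show ?thesis by (simp add: r_def D_def s_def a_def c_def)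
qed

lemma graph_matrix_plus_unit:
  "graph_matrix p q + t *\<^sub>R matrix_unit 3 1 = graph_matrix (p + t) q"
  "graph_matrix p q + t *\<^sub>R matrix_unit 3 2 = graph_matrix p (q + t)"
  by (simp_all add: graph_matrix_def matrix_unit_def vec_eq_iff forall_2 forall_3 vector_2 vector_3 axis_def)

lemma partial_deriv_BH:
  assumes b: "0 \<le> b" "b < 1"
  shows "partial_deriv (matrix_unit 3 1) (BH_density b) (graph_matrix p q) = 2 * p * density_profile' b (1 + p\<^sup>2 + q\<^sup>2)"
    and "partial_deriv (matrix_unit 3 2) (BH_density b) (graph_matrix p q) = 2 * q * density_profile' b (1 + p\<^sup>2 + q\<^sup>2)"
proof -
  have "((\<lambda>t. graph_density b (p + t) q) has_real_derivative 2 * p * density_profile' b (1 + p\<^sup>2 + q\<^sup>2)) (at 0)" for p q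
    using graph_density_deriv[of b q p] DERIV_shift[of "\<lambda>p. graph_density b p q" _ 0 p] by (simp add: add.commute)
  note * = DERIV_imp_deriv[OF this]
  show "partial_deriv (matrix_unit 3 1) (BH_density b) (graph_matrix p q) = 2 * p * density_profile' b (1 + p\<^sup>2 + q\<^sup>2)"
    by (simp add: partial_deriv_def graph_matrix_plus_unit BH_density_graph_matrix[OF b] *)
  show "partial_deriv (matrix_unit 3 2) (BH_density b) (graph_matrix p q) = 2 * q * density_profile' b (1 + p\<^sup>2 + q\<^sup>2)"
    using *[of q p]
    by (simp add: partial_deriv_def graph_matrix_plus_unit BH_density_graph_matrix[OF b] graph_density_commute[of b p] add_ac)
qed

lemma partial_deriv2_BH:
  fixes b p q :: real
  assumes b: "0 \<le> b" "b < 1"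
  defines "k \<equiv> \<lambda>p q. 2 / (sqrt (1 + p\<^sup>2 + q\<^sup>2) * ((2 + b\<^sup>2) * (1 + p\<^sup>2 + q\<^sup>2) - b\<^sup>2) ^ 3)"
  shows "partial_deriv (matrix_unit 3 1) (partial_deriv (matrix_unit 3 1) (BH_density b)) (graph_matrix p q)
          = k p q * elliptic_coeff b p q"
    and "partial_deriv (matrix_unit 3 2) (partial_deriv (matrix_unit 3 2) (BH_density b)) (graph_matrix p q)
          = k p q * elliptic_coeff b q p"
proof -
  have "((\<lambda>t. 2 * (p + t) * density_profile' b (1 + (p + t)\<^sup>2 + q\<^sup>2)) has_real_derivative k p q * elliptic_coeff b p q) (at 0)" for p q
    using graph_density_deriv2[of b q p] DERIV_shift[of "\<lambda>p. 2 * p * density_profile' b (1 + p\<^sup>2 + q\<^sup>2)" _ 0 p]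
    by (simp add: k_def add.commute)
  note * = DERIV_imp_deriv[OF this]
  show "partial_deriv (matrix_unit 3 1) (partial_deriv (matrix_unit 3 1) (BH_density b)) (graph_matrix p q)
          = k p q * elliptic_coeff b p q"
    unfolding partial_deriv_def[of _ "partial_deriv _ _"] graph_matrix_plus_unit partial_deriv_BH[OF b] by (rule *)
  have "k q p = k p q" by (simp add: k_def add_ac)
  then show "partial_deriv (matrix_unit 3 2) (partial_deriv (matrix_unit 3 2) (BH_density b)) (graph_matrix p q)
          = k p q * elliptic_coeff b q p"
    unfolding partial_deriv_def[of _ "partial_deriv _ _"] graph_matrix_plus_unit partial_deriv_BH[OF b]
    using *[of q p] by (simp add: add_ac)
qed

section \<open>Ellipticity and growth\<close>

text \<open>Put \<open>a = 2 + b\<^sup>2\<close>, \<open>c = b\<^sup>2\<close> and \<open>s = 1 + p\<^sup>2 + q\<^sup>2\<close>. Because of \<open>s - q\<^sup>2 = 1 + p\<^sup>2\<close> the leading terms combine to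
  \<open>a\<^sup>2 s\<^sup>2 (1 + p\<^sup>2)\<close>, and the only negative term left is \<open>-4 a c s\<^sup>2\<close>. Since it is at least
  \<open>-4 a c s\<^sup>2 (1 + p\<^sup>2)\<close>, the factor \<open>a - 4 c = 2 - 3 b\<^sup>2\<close> appears.\<close>

lemma elliptic_coeff_lower_bound:
  "(2 + b\<^sup>2) * (2 - 3 * b\<^sup>2) * (1 + p\<^sup>2 + q\<^sup>2)\<^sup>2 * (1 + p\<^sup>2) \<le> elliptic_coeff b q p"
proof -
  define s a c where "s = 1 + p\<^sup>2 + q\<^sup>2" and "a = 2 + b\<^sup>2" and "c = b\<^sup>2"
  have nn: "a \<ge> 0" "c \<ge> 0" "s \<ge> 0" by (simp_all add: s_def a_def c_def)
  have ac: "2 - 3 * b\<^sup>2 = a - 4 * c" by (simp add: a_def c_def)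
  have q: "q\<^sup>2 = s - 1 - p\<^sup>2" by (simp add: s_def)
  have "elliptic_coeff b q p = s * (a * s - 3 * c) * (a * s - c) - q\<^sup>2 * (a\<^sup>2 * s\<^sup>2 - 6 * a * c * s - 3 * c\<^sup>2)"
    by (simp add: elliptic_coeff_def Let_def s_def a_def c_def add_ac)
  also have "\<dots> = a * (a - 4 * c) * s\<^sup>2 * (1 + p\<^sup>2) +
      (4 * a * c * s\<^sup>2 * p\<^sup>2 + 3 * c\<^sup>2 * s + 6 * a * c * s * q\<^sup>2 + 3 * c\<^sup>2 * q\<^sup>2)"
    unfolding q by (simp add: algebra_simps power2_eq_square)
  also have "\<dots> \<ge> a * (a - 4 * c) * s\<^sup>2 * (1 + p\<^sup>2)"
    using nn by simp
  finally show ?thesis unfolding ac by (simp add: s_def a_def c_def)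
qed

lemma elliptic_coeff_pos:
  assumes "0 \<le> b" "b < 1 / 2"
  shows "elliptic_coeff b p q > 0"
proof -
  have "b\<^sup>2 \<le> (1 / 2)\<^sup>2" using assms by (intro power_mono) auto
  then have "0 < (2 + b\<^sup>2) * (2 - 3 * b\<^sup>2) * (1 + q\<^sup>2 + p\<^sup>2)\<^sup>2 * (1 + q\<^sup>2)"
    by (intro mult_pos_pos zero_less_power add_pos_nonneg) (auto simp: power2_eq_square)
  also have "\<dots> \<le> elliptic_coeff b p q" by (rule elliptic_coeff_lower_bound)
  finally show ?thesis .
qed

text \<open>For fixed \<open>q\<close> the terms of degree 6 in \<open>p\<close> cancel, so that the coefficient grows only like
  \<open>p\<^sup>4\<close>. Compared with the lower bound, where the variables are exchanged, a factor of order
  \<open>1 + p\<^sup>2\<close> is gained.\<close>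

lemma elliptic_coeff_upper_bound:
  fixes b q :: real
  obtains C where "C > 0" "\<And>p. elliptic_coeff b p q \<le> C * (1 + p\<^sup>2 + q\<^sup>2)\<^sup>2"
proof
  define a c where "a = 2 + b\<^sup>2" and "c = b\<^sup>2"
  have nn: "a > 0" "c \<ge> 0" by (simp_all add: a_def c_def add_pos_nonneg)
  show "a\<^sup>2 * (1 + q\<^sup>2) + (6 * c\<^sup>2 + 6 * a * c) > 0"
    using nn by (intro add_pos_nonneg mult_pos_pos) auto
  fix p
  define s where "s = 1 + p\<^sup>2 + q\<^sup>2"
  have s: "s \<ge> 1" "p\<^sup>2 \<le> s" by (simp_all add: s_def)
  have ss: "s \<le> s\<^sup>2" using s by (simp add: power2_eq_square)
  have "s * p\<^sup>2 \<le> s\<^sup>2" "p\<^sup>2 \<le> s\<^sup>2"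
    using s ss by (auto simp: power2_eq_square[of s] intro: mult_left_mono order_trans)
  have q: "q\<^sup>2 = s - 1 - p\<^sup>2" by (simp add: s_def)
  have "elliptic_coeff b p q = s * (a * s - 3 * c) * (a * s - c) - p\<^sup>2 * (a\<^sup>2 * s\<^sup>2 - 6 * a * c * s - 3 * c\<^sup>2)"
    by (simp add: elliptic_coeff_def Let_def s_def a_def c_def add_ac)
  also have "\<dots> = a\<^sup>2 * (1 + q\<^sup>2) * s\<^sup>2 + (3 * c\<^sup>2 * s + 6 * a * c * (s * p\<^sup>2) + 3 * c\<^sup>2 * p\<^sup>2 - 4 * a * c * s\<^sup>2)"
    unfolding q by (simp add: algebra_simps power2_eq_square)
  also have "\<dots> \<le> a\<^sup>2 * (1 + q\<^sup>2) * s\<^sup>2 + (3 * c\<^sup>2 * s\<^sup>2 + 6 * a * c * s\<^sup>2 + 3 * c\<^sup>2 * s\<^sup>2 - 0)"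
    using nn ss \<open>s * p\<^sup>2 \<le> s\<^sup>2\<close> \<open>p\<^sup>2 \<le> s\<^sup>2\<close>
    by (intro add_mono diff_mono mult_left_mono order_refl) auto
  finally show "elliptic_coeff b p q \<le> (a\<^sup>2 * (1 + q\<^sup>2) + (6 * c\<^sup>2 + 6 * a * c)) * (1 + p\<^sup>2 + q\<^sup>2)\<^sup>2"
    by (simp add: s_def algebra_simps)
qed

text \<open>Under this inequality \<open>arctan u\<close> grows at least at rate \<open>k\<close>, so over an interval of
  length \<open>pi / k\<close> it would leave its range.\<close>

lemma no_global_riccati_supersolution:
  fixes u u' :: "real \<Rightarrow> real"
  assumes der: "\<And>x. (u has_real_derivative u' x) (at x)"
    and k: "k > 0" and ineq: "\<And>x. k * (1 + (u x)\<^sup>2) \<le> u' x"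
  shows False
proof -
  have "pi / k > 0" using k by simp
  have d: "((\<lambda>x. arctan (u x)) has_real_derivative u' x / (1 + (u x)\<^sup>2)) (at x)" for x
    using der[of x] by (auto intro!: derivative_eq_intros simp: field_simps)
  obtain z where "arctan (u (pi / k)) - arctan (u 0) = (pi / k - 0) * (u' z / (1 + (u z)\<^sup>2))"
    using MVT2[OF \<open>pi / k > 0\<close> d] by blast
  moreover have "k \<le> u' z / (1 + (u z)\<^sup>2)"
    using ineq[of z] by (simp add: pos_le_divide_eq add_pos_nonneg)
  then have "(pi / k - 0) * (u' z / (1 + (u z)\<^sup>2)) \<ge> (pi / k - 0) * k"
    using \<open>pi / k > 0\<close> by (intro mult_left_mono) auto
  ultimately have "arctan (u (pi / k)) - arctan (u 0) \<ge> pi" using k by simp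
  then show False
    using arctan_bounded[of "u (pi / k)"] arctan_bounded[of "u 0"] by linarith
qed

text \<open>If \<open>v' y < 0\<close> for a single \<open>y\<close>, freeze this \<open>y\<close>. The equation then expresses \<open>u'\<close> as a
  positive constant times a quotient of the two coefficients, and by the growth bounds this
  quotient is at least a multiple of \<open>1 + u\<^sup>2\<close>.\<close>

lemma minimal_equation_nonneg:
  fixes u u' v v' :: "real \<Rightarrow> real"
  assumes b: "0 \<le> b" "b < 1 / 2"
    and der: "\<And>x. (u has_real_derivative u' x) (at x)"
    and eq: "\<And>x y. elliptic_coeff b (u x) (v y) * u' x + elliptic_coeff b (v y) (u x) * v' y = 0"
  shows "v' y \<ge> 0"
proof (rule ccontr)
  assume "\<not> v' y \<ge> 0"
  then have neg: "- v' y > 0" by simp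
  define q where "q = v y"
  define m where "m = (2 + b\<^sup>2) * (2 - 3 * b\<^sup>2)"
  have "b\<^sup>2 \<le> (1 / 2)\<^sup>2" using b by (intro power_mono) auto
  then have m: "m > 0" unfolding m_def by (intro mult_pos_pos add_pos_nonneg) (auto simp: power2_eq_square)
  obtain C where C: "C > 0" and up: "\<And>p. elliptic_coeff b p q \<le> C * (1 + p\<^sup>2 + q\<^sup>2)\<^sup>2"
    using elliptic_coeff_upper_bound by blast
  have "(- v' y) * m / C * (1 + (u x)\<^sup>2) \<le> u' x" for x
  proof -
    let ?s = "1 + (u x)\<^sup>2 + q\<^sup>2"
    have s: "?s\<^sup>2 > 0" by (intro zero_less_power add_pos_nonneg) auto
    have lo: "m * ?s\<^sup>2 * (1 + (u x)\<^sup>2) \<le> elliptic_coeff b q (u x)"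
      unfolding m_def by (rule elliptic_coeff_lower_bound)
    have e: "elliptic_coeff b (u x) q * u' x = elliptic_coeff b q (u x) * (- v' y)"
      using eq[of x y] by (simp add: q_def)
    have "elliptic_coeff b (u x) q * u' x > 0"
      unfolding e using neg elliptic_coeff_pos[OF b] by (intro mult_pos_pos)
    then have "u' x \<ge> 0"
      using elliptic_coeff_pos[OF b, of "u x" q] by (simp add: zero_less_mult_iff)
    have "m * ?s\<^sup>2 * (1 + (u x)\<^sup>2) * (- v' y) \<le> elliptic_coeff b q (u x) * (- v' y)"
      using neg lo by (intro mult_right_mono) auto
    also have "\<dots> \<le> C * ?s\<^sup>2 * u' x"
      unfolding e[symmetric] using up \<open>u' x \<ge> 0\<close> by (intro mult_right_mono) auto
    finally have "?s\<^sup>2 * (m * (1 + (u x)\<^sup>2) * (- v' y)) \<le> ?s\<^sup>2 * (C * u' x)"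
      by (simp add: mult_ac)
    then have "m * (1 + (u x)\<^sup>2) * (- v' y) \<le> C * u' x"
      using s by (simp only: mult_le_cancel_left_pos)
    then show ?thesis using C by (simp add: field_simps)
  qed
  with no_global_riccati_supersolution[OF der, of "(- v' y) * m / C"] show False
    using neg m C by (simp add: divide_neg_pos mult_neg_pos)
qed

section \<open>The equation of minimal translation surfaces\<close>

lemma smooth_derivs:
  assumes "smooth f"
  shows "(f has_real_derivative deriv f x) (at x)"
    and "(deriv f has_real_derivative deriv (deriv f) x) (at x)"
proof -
  have "(deriv ^^ 0) f field_differentiable at x" "(deriv ^^ 1) f field_differentiable at x"
    using assms unfolding smooth_def by blast+
  then show "(f has_real_derivative deriv f x) (at x)"
    and "(deriv f has_real_derivative deriv (deriv f) x) (at x)"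
    by (simp_all add: field_differentiable_derivI)
qed

text \<open>With a constant as one of the summands this also covers functions of a single coordinate,
  in particular the coordinates themselves and the first derivatives of the height.\<close>

lemma partial_deriv_separated:
  fixes h k :: "real \<Rightarrow> real" and x :: "real^2"
  assumes h: "\<And>s. (h has_real_derivative h' s) (at s)" and k: "\<And>s. (k has_real_derivative k' s) (at s)"
  shows "partial_deriv (axis 1 1) (\<lambda>u. h (u $ 1) + k (u $ 2)) x = h' (x $ 1)"
    and "partial_deriv (axis 2 1) (\<lambda>u. h (u $ 1) + k (u $ 2)) x = k' (x $ 2)"
proof -
  have *: "((\<lambda>t. l (s + t)) has_real_derivative l' s) (at 0)"
    if "\<And>s. (l has_real_derivative l' s) (at s)" for l l' :: "real \<Rightarrow> real" and s
    using that[of s] DERIV_shift[of l "l' s" 0 s] by (simp add: add.commute)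
  show "partial_deriv (axis 1 1) (\<lambda>u. h (u $ 1) + k (u $ 2)) x = h' (x $ 1)"
    using DERIV_imp_deriv[OF DERIV_add[OF *[OF h] DERIV_const]]
    by (simp add: partial_deriv_def axis_def)
  show "partial_deriv (axis 2 1) (\<lambda>u. h (u $ 1) + k (u $ 2)) x = k' (x $ 2)"
    using DERIV_imp_deriv[OF DERIV_add[OF DERIV_const *[OF k]]]
    by (simp add: partial_deriv_def axis_def)
qed

lemma translation_surface_nth:
  "translation_surface f g u $ 1 = u $ 1"
  "translation_surface f g u $ 2 = u $ 2"
  "translation_surface f g u $ 3 = f (u $ 1) + g (u $ 2)"
  by (simp_all add: translation_surface_def vector_3)

lemma translation_surface_partials:
  assumes "smooth f" "smooth g"
  shows "partial_deriv (axis 1 1) (\<lambda>u. translation_surface f g u $ 1) = (\<lambda>x. 1)"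
    "partial_deriv (axis 2 1) (\<lambda>u. translation_surface f g u $ 1) = (\<lambda>x. 0)"
    "partial_deriv (axis 1 1) (\<lambda>u. translation_surface f g u $ 2) = (\<lambda>x. 0)"
    "partial_deriv (axis 2 1) (\<lambda>u. translation_surface f g u $ 2) = (\<lambda>x. 1)"
    "partial_deriv (axis 1 1) (\<lambda>u. translation_surface f g u $ 3) = (\<lambda>x. deriv f (x $ 1))"
    "partial_deriv (axis 2 1) (\<lambda>u. translation_surface f g u $ 3) = (\<lambda>x. deriv g (x $ 2))"
  using partial_deriv_separated[OF DERIV_ident DERIV_const[of 0]]
    partial_deriv_separated[OF DERIV_const[of 0] DERIV_ident]
    partial_deriv_separated[OF smooth_derivs(1)[OF assms(1)] smooth_derivs(1)[OF assms(2)]]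
  by (simp_all add: translation_surface_nth fun_eq_iff)

lemma jacobian_translation_surface:
  assumes "smooth f" "smooth g"
  shows "jacobian_matrix (translation_surface f g) x = graph_matrix (deriv f (x $ 1)) (deriv g (x $ 2))"
  by (simp add: jacobian_matrix_def graph_matrix_def vec_eq_iff forall_2 forall_3 vector_2 vector_3
      translation_surface_partials[OF assms]) (simp add: axis_def)

text \<open>Of the three coordinates of the surface only the height has second derivatives, and its mixed
  derivative vanishes because the two variables are separated.\<close>

lemma mean_curvature_translation_surface:
  assumes b: "0 \<le> b" "b < 1" and sm: "smooth f" "smooth g"
  defines "z \<equiv> jacobian_matrix (translation_surface f g)"
  shows "mean_curvature b (translation_surface f g) (\<lambda>x. axis 3 1) x =
    1 / BH_density b (z x) *
     (partial_deriv (matrix_unit 3 1) (partial_deriv (matrix_unit 3 1) (BH_density b)) (z x) * deriv (deriv f) (x $ 1) +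
      partial_deriv (matrix_unit 3 2) (partial_deriv (matrix_unit 3 2) (BH_density b)) (z x) * deriv (deriv g) (x $ 2))"
proof -
  have c: "partial_deriv e (\<lambda>x. c) = (\<lambda>x. 0)" for e :: "real^2" and c :: real
    by (simp add: partial_deriv_def fun_eq_iff)
  note sep = partial_deriv_separated[OF smooth_derivs(2)[OF sm(1)] DERIV_const[of 0]]
    partial_deriv_separated[OF DERIV_const[of 0] smooth_derivs(2)[OF sm(2)]]
  show ?thesis
    unfolding mean_curvature_def z_def[symmetric]
    by (simp only: sum_2 sum_3 translation_surface_partials[OF sm] c sep[simplified]) (simp add: axis_def)
qed

text \<open>Minimality is used with the constant vertical field only. The two second derivatives of the
  density share a positive factor, which is divided out.\<close>

lemma minimal_translation_surface_equation:
  assumes b: "0 \<le> b" "b < 1 / 2" and sm: "smooth f" "smooth g"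
    and minimal: "minimal b (translation_surface f g)"
  shows "elliptic_coeff b (deriv f s) (deriv g t) * deriv (deriv f) s + elliptic_coeff b (deriv g t) (deriv f s) * deriv (deriv g) t = 0"
proof -
  have b1: "b < 1" using b by simp
  define x :: "real^2" where "x = vector [s, t]"
  have x: "x $ 1 = s" "x $ 2 = t" by (simp_all add: x_def vector_2)
  define S where "S = 1 + (deriv f s)\<^sup>2 + (deriv g t)\<^sup>2"
  define D where "D = (2 + b\<^sup>2) * S - b\<^sup>2"
  have S: "S \<ge> 1" by (simp add: S_def)
  have D: "D > 0" unfolding D_def by (rule denominator_pos[OF S])
  have BH: "BH_density b (graph_matrix (deriv f s) (deriv g t)) = 2 * (S * sqrt S) / D"
    by (simp add: BH_density_graph_matrix[OF b(1) b1] graph_density_def S_def D_def)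
  have "mean_curvature b (translation_surface f g) (\<lambda>x. axis 3 1) x = 0"
    using minimal by (simp add: minimal_def)
  then have "1 / (2 * (S * sqrt S) / D) * (2 / (sqrt S * D ^ 3) *
     (elliptic_coeff b (deriv f s) (deriv g t) * deriv (deriv f) s + elliptic_coeff b (deriv g t) (deriv f s) * deriv (deriv g) t)) = 0"
    unfolding mean_curvature_translation_surface[OF b(1) b1 sm] jacobian_translation_surface[OF sm]
      partial_deriv2_BH[OF b(1) b1] x BH S_def[symmetric] D_def[symmetric]
    by (simp only: distrib_left mult.assoc)
  then show ?thesis
    using S D by simp
qed

section \<open>Minimal translation surfaces are planes\<close>

lemma zero_deriv2_imp_affine:
  assumes "smooth f" "\<And>x. deriv (deriv f) x = 0"
  obtains m where "\<And>x. f x = m * x + f 0"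
proof
  fix x
  have "deriv f y = deriv f 0" for y
    using DERIV_isconst_all[of "deriv f" y 0] smooth_derivs(2)[OF assms(1)] assms(2) by simp
  then have "((\<lambda>x. f x - deriv f 0 * x) has_real_derivative 0) (at y)" for y
    using smooth_derivs(1)[OF assms(1), of y] by (auto intro!: derivative_eq_intros)
  from DERIV_isconst_all[of "\<lambda>x. f x - deriv f 0 * x" x 0, OF allI[OF this]]
  show "f x = deriv f 0 * x + f 0" by simp
qed

lemma range_affine_graph:
  fixes m n c :: real
  shows "plane (range (translation_surface (\<lambda>x. m * x + c) (\<lambda>y. n * y + d)))"
proof -
  define a :: "real^3" where "a = vector [- m, - n, 1]"
  have "range (translation_surface (\<lambda>x. m * x + c) (\<lambda>y. n * y + d)) = {w. a \<bullet> w = c + d}"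
  proof (intro equalityI subsetI)
    fix w assume "w \<in> {w. a \<bullet> w = c + d}"
    then have "w = translation_surface (\<lambda>x. m * x + c) (\<lambda>y. n * y + d) (vector [w $ 1, w $ 2])"
      by (simp add: translation_surface_nth vec_eq_iff forall_3 vector_2 a_def inner_vec_def sum_3 vector_3)
    then show "w \<in> range (translation_surface (\<lambda>x. m * x + c) (\<lambda>y. n * y + d))" by blast
  qed (auto simp: translation_surface_nth a_def inner_vec_def sum_3 vector_3)
  moreover have "a \<noteq> 0" by (auto simp: a_def vec_eq_iff forall_3 vector_3)
  ultimately show ?thesis
    by (simp add: plane_def affine_hyperplane)
qed

theorem theorem5p2:
  fixes b :: real and f g :: "real \<Rightarrow> real"
  assumes "0 \<le> b" and "b < 1 / 2"
    and "smooth f" and "smooth g"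
    and "minimal b (translation_surface f g)"
  shows "plane (range (translation_surface f g))"
proof -
  let ?F = "deriv (deriv f)" and ?G = "deriv (deriv g)"
  have b1: "b < 1" using assms(2) by simp
  have eq: "elliptic_coeff b (deriv f x) (deriv g y) * ?F x + elliptic_coeff b (deriv g y) (deriv f x) * ?G y = 0" for x y
    by (rule minimal_translation_surface_equation[OF assms])
  have G: "?G y \<ge> 0" for y
    using minimal_equation_nonneg[OF assms(1,2) smooth_derivs(2)[OF assms(3)] eq] .
  have F: "?F x \<ge> 0" for x
    using minimal_equation_nonneg[OF assms(1,2) smooth_derivs(2)[OF assms(4)], where v = "deriv f" and v' = ?F] eq
    by (simp add: add.commute)
  have "?F x = 0 \<and> ?G y = 0" for x y
  proof -
    have P: "elliptic_coeff b (deriv f x) (deriv g y) > 0" "elliptic_coeff b (deriv g y) (deriv f x) > 0"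
      by (intro elliptic_coeff_pos assms)+
    then have "elliptic_coeff b (deriv f x) (deriv g y) * ?F x \<ge> 0" "elliptic_coeff b (deriv g y) (deriv f x) * ?G y \<ge> 0"
      using F[of x] G[of y] by simp_all
    then show ?thesis using eq[of x y] P by (simp add: add_nonneg_eq_0_iff)
  qed
  then obtain m n where "\<And>x. f x = m * x + f 0" "\<And>y. g y = n * y + g 0"
    using zero_deriv2_imp_affine assms(3,4) by metis
  then have "f = (\<lambda>x. m * x + f 0)" "g = (\<lambda>y. n * y + g 0)" by blast+
  then show ?thesis
    using range_affine_graph by metis
qed

end
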